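(* Let $\lambda\in\mathbb{C}^*$ and $\alpha\in\mathbb{C}$, and let $\Phi(\lambda,\alpha)=\mathbb{C}[s,t,v]$ be the polynomial algebra in three indeterminates. For $m\in\mathbb{Z}$ and $f(s,t,v)\in\mathbb{C}[s,t,v]$ set $$L_m\cdot f(s,t,v)=\lambda^m\left((s+m\alpha)f(s-m,t,v)-\frac m2 v\frac{\partial f(s-m,t,v)}{\partial v}+\frac{m^2}{4}t\frac{\partial^2 f(s-m,t,v)}{\partial v^2}\right),$$ $$M_m\cdot f(s,t,v)=\lambda^m t f(s-m,t,v),$$ $$Y_m\cdot f(s,t,v)=\lambda^m\left(vf(s-m,t,v)-mt\frac{\partial f(s-m,t,v)}{\partial v}\right).$$ Then these formulas make $\Phi(\lambda,\alpha)$ an $\mathfrak{sv}(0)$-module, and this module is free of rank $1$ as a $U(\mathbb{C}L_0\oplus\mathbb{C}M_0\oplus\mathbb{C}Y_0)$-module.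
   Context: $\mathbb{C}^*=\mathbb{C}\setminus\{0\}$. The Schrödinger-Virasoro algebra $\mathfrak{sv}(0)$ is the complex Lie algebra with basis $\{L_n,Y_n,M_n\mid n\in\mathbb{Z}\}$ and brackets, for $m,n\in\mathbb{Z}$, $$[L_n,L_m]=(m-n)L_{m+n},\quad [L_n,Y_m]=\left(m-\tfrac n2\right)Y_{m+n},\quad [L_n,M_m]=mM_{m+n},$$ $$[Y_n,Y_m]=(m-n)M_{m+n},\quad [Y_n,M_m]=[M_n,M_m]=0.$$ The span $\mathbb{C}L_0\oplus\mathbb{C}M_0\oplus\mathbb{C}Y_0$ is an abelian Lie subalgebra with universal enveloping algebra $\mathbb{C}[L_0,M_0,Y_0]$. *)

theory Defs
  imports
    Complex_Main
    "HOL-Library.Poly_Mapping"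
    "HOL-Computational_Algebra.Polynomial"
begin

section \<open>Lie algebras and their modules\<close>

locale lie_algebra = vector_space scale
  for scale :: "'k::field \<Rightarrow> 'g::ab_group_add \<Rightarrow> 'g" +
  fixes bracket :: "'g \<Rightarrow> 'g \<Rightarrow> 'g"
  assumes bracket_linear_left: "\<And>y. Vector_Spaces.linear scale scale (\<lambda>x. bracket x y)"
    and bracket_linear_right: "\<And>x. Vector_Spaces.linear scale scale (bracket x)"
    and bracket_alternating: "\<And>x. bracket x x = 0"
    and jacobi: "\<And>x y z. bracket x (bracket y z) + bracket y (bracket z x) + bracket z (bracket x y) = 0"

locale lie_module = lie_algebra scale bracket + V: vector_space scaleV
  for scale :: "'k::field \<Rightarrow> 'g::ab_group_add \<Rightarrow> 'g"
    and bracket :: "'g \<Rightarrow> 'g \<Rightarrow> 'g"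
    and scaleV :: "'k \<Rightarrow> 'v::ab_group_add \<Rightarrow> 'v" +
  fixes action :: "'g \<Rightarrow> 'v \<Rightarrow> 'v"
  assumes action_linear_left: "\<And>w. Vector_Spaces.linear scale scaleV (\<lambda>x. action x w)"
    and action_linear_right: "\<And>x. Vector_Spaces.linear scaleV scaleV (action x)"
    and action_bracket: "\<And>x y w. action (bracket x y) w = action x (action y w) - action y (action x w)"

definition free_module_of_rank :: "('r::comm_ring_1 \<Rightarrow> 'v::ab_group_add \<Rightarrow> 'v) \<Rightarrow> nat \<Rightarrow> bool" where
  "free_module_of_rank act n \<longleftrightarrow> module act \<and>
     (\<exists>B. finite B \<and> card B = n \<and> \<not> module.dependent act B \<and> module.span act B = UNIV)"


section \<open>The Schroedinger-Virasoro algebra\<close>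

datatype sv_gen = L int | Y int | M int

text \<open>The vector space with basis indexed by \<open>sv_gen\<close> consists of the finitely supported
  functions from \<open>sv_gen\<close> to the complex numbers.\<close>

type_synonym sv = "sv_gen \<Rightarrow>\<^sub>0 complex"

definition sv_scale :: "complex \<Rightarrow> sv \<Rightarrow> sv" where
  "sv_scale c x = Poly_Mapping.map ((*) c) x"

abbreviation sv_basis :: "sv_gen \<Rightarrow> sv" where
  "sv_basis g \<equiv> Poly_Mapping.single g 1"

fun sv_gen_bracket :: "sv_gen \<Rightarrow> sv_gen \<Rightarrow> sv" where
  "sv_gen_bracket (L n) (L m) = Poly_Mapping.single (L (m + n)) (of_int (m - n))"
| "sv_gen_bracket (L n) (Y m) = Poly_Mapping.single (Y (m + n)) (of_int m - of_int n / 2)"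
| "sv_gen_bracket (L n) (M m) = Poly_Mapping.single (M (m + n)) (of_int m)"
| "sv_gen_bracket (Y n) (Y m) = Poly_Mapping.single (M (m + n)) (of_int (m - n))"
| "sv_gen_bracket (Y n) (M m) = 0"
| "sv_gen_bracket (M n) (M m) = 0"
| "sv_gen_bracket (Y m) (L n) = - Poly_Mapping.single (Y (m + n)) (of_int m - of_int n / 2)"
| "sv_gen_bracket (M m) (L n) = - Poly_Mapping.single (M (m + n)) (of_int m)"
| "sv_gen_bracket (M m) (Y n) = 0"

definition sv_bracket :: "sv \<Rightarrow> sv \<Rightarrow> sv" where
  "sv_bracket x y =
     (\<Sum>g\<in>Poly_Mapping.keys x. \<Sum>h\<in>Poly_Mapping.keys y.
        sv_scale (Poly_Mapping.lookup x g * Poly_Mapping.lookup y h) (sv_gen_bracket g h))"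


section \<open>Polynomials in three variables\<close>

text \<open>The ring \<open>\<complex>[a,b,c]\<close> is the iterated polynomial ring \<open>\<complex>[a][b][c]\<close>: the first variable is
  the innermost one.\<close>

type_synonym poly3 = "complex poly poly poly"

definition poly3_scale :: "complex \<Rightarrow> poly3 \<Rightarrow> poly3" where
  "poly3_scale c f = smult [:[:c:]:] f"

definition var_s :: poly3 where "var_s = [:[:[:0, 1:]:]:]"
definition var_t :: poly3 where "var_t = [:[:0, 1:]:]"
definition var_v :: poly3 where "var_v = [:0, 1:]"

text \<open>\<open>f(s - m, t, v)\<close>; the partial derivative with respect to the outermost variable \<open>v\<close> is
  \<^const>\<open>pderiv\<close>.\<close>

definition shift_s :: "int \<Rightarrow> poly3 \<Rightarrow> poly3" where
  "shift_s m f = map_poly (map_poly (\<lambda>p. pcompose p [:- of_int m, 1:])) f"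


section \<open>The action on \<open>\<Phi>(\<lambda>, \<alpha>)\<close>\<close>

fun Phi_gen_action :: "complex \<Rightarrow> complex \<Rightarrow> sv_gen \<Rightarrow> poly3 \<Rightarrow> poly3" where
  "Phi_gen_action lam \<alpha> (L m) f = poly3_scale (lam powi m)
     ((var_s + poly3_scale (of_int m * \<alpha>) 1) * shift_s m f
      - poly3_scale (of_int m / 2) (var_v * pderiv (shift_s m f))
      + poly3_scale ((of_int m)\<^sup>2 / 4) (var_t * pderiv (pderiv (shift_s m f))))"
| "Phi_gen_action lam \<alpha> (M m) f = poly3_scale (lam powi m) (var_t * shift_s m f)"
| "Phi_gen_action lam \<alpha> (Y m) f = poly3_scale (lam powi m)
     (var_v * shift_s m f - poly3_scale (of_int m) (var_t * pderiv (shift_s m f)))"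

definition Phi_action :: "complex \<Rightarrow> complex \<Rightarrow> sv \<Rightarrow> poly3 \<Rightarrow> poly3" where
  "Phi_action lam \<alpha> x f =
     (\<Sum>g\<in>Poly_Mapping.keys x. poly3_scale (Poly_Mapping.lookup x g) (Phi_gen_action lam \<alpha> g f))"


section \<open>The enveloping algebra of \<open>\<complex>L\<^sub>0 \<oplus> \<complex>M\<^sub>0 \<oplus> \<complex>Y\<^sub>0\<close>\<close>

text \<open>This Lie algebra is abelian, with basis \<open>L\<^sub>0, M\<^sub>0, Y\<^sub>0\<close>, so its enveloping algebra is the
  polynomial ring \<open>\<complex>[L\<^sub>0, M\<^sub>0, Y\<^sub>0]\<close>. Given an action of \<open>\<ss>\<vv>(0)\<close> on a vector space, the monomial
  \<open>L\<^sub>0\<^sup>i M\<^sub>0\<^sup>j Y\<^sub>0\<^sup>k\<close> acts by composing the operators by which the three basis elements act.\<close>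

type_synonym U0 = poly3

definition U0_action :: "(complex \<Rightarrow> 'v::ab_group_add \<Rightarrow> 'v) \<Rightarrow> (sv \<Rightarrow> 'v \<Rightarrow> 'v) \<Rightarrow> U0 \<Rightarrow> 'v \<Rightarrow> 'v" where
  "U0_action scaleV action u w =
     (\<Sum>k\<le>degree u. \<Sum>j\<le>degree (coeff u k). \<Sum>i\<le>degree (coeff (coeff u k) j).
        scaleV (coeff (coeff (coeff u k) j) i)
          ((action (sv_basis (L 0)) ^^ i)
            ((action (sv_basis (M 0)) ^^ j)
              ((action (sv_basis (Y 0)) ^^ k) w))))"

end

theory Submission
  imports Defs
begin

text \<open>All identities are multilinear, so they need only be checked on the basis of \<open>\<ss>\<vv>(0)\<close>.
  The substitution \<open>f \<mapsto> f(s - m, t, v)\<close> is a ring endomorphism commuting with the derivative in \<open>v\<close>,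
  which turns the module axiom for basis elements into a ring identity in the successive
  \<open>v\<close>-derivatives of \<open>f(s - m - n, t, v)\<close>. Since \<open>L\<^sub>0\<close>, \<open>M\<^sub>0\<close>, \<open>Y\<^sub>0\<close> act as multiplication by \<open>s\<close>, \<open>t\<close>,
  \<open>v\<close>, the enveloping algebra acts by multiplication of polynomials, freely on the generator 1.\<close>

section \<open>The underlying vector space and linear extension from its basis\<close>

lemma lookup_sv_scale [simp]:
  "Poly_Mapping.lookup (sv_scale c x) g = c * Poly_Mapping.lookup x g"
  by (simp add: sv_scale_def Poly_Mapping.map.rep_eq when_def)

lemma vector_space_sv_scale: "vector_space sv_scale"
  by unfold_locales (auto intro!: poly_mapping_eqI simp: lookup_add algebra_simps)

interpretation sv: vector_space sv_scale
  by (rule vector_space_sv_scale)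

lemma sv_scale_single [simp]:
  "sv_scale c (Poly_Mapping.single g a) = Poly_Mapping.single g (c * a)"
  by (simp add: sv_scale_def)

lemma keys_sv_scale: "c \<noteq> 0 \<Longrightarrow> Poly_Mapping.keys (sv_scale c x) = Poly_Mapping.keys x"
  by (auto simp: in_keys_iff)

lemma sv_eq_sum_basis:
  "x = (\<Sum>g\<in>Poly_Mapping.keys x. sv_scale (Poly_Mapping.lookup x g) (sv_basis g))"
proof (rule poly_mapping_eqI)
  fix h
  show "Poly_Mapping.lookup x h = Poly_Mapping.lookup
    (\<Sum>g\<in>Poly_Mapping.keys x. sv_scale (Poly_Mapping.lookup x g) (sv_basis g)) h"
    by (simp add: lookup_sum lookup_single when_def in_keys_iff)
qed

text \<open>The linear map with prescribed values \<open>f\<close> on the basis. Both the bracket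
  and the action are instances, so one linearity proof serves for both.\<close>

definition sv_extend ::
  "(complex \<Rightarrow> 'v \<Rightarrow> 'v::ab_group_add) \<Rightarrow> (sv_gen \<Rightarrow> 'v) \<Rightarrow> sv \<Rightarrow> 'v" where
  "sv_extend scale f x = (\<Sum>g\<in>Poly_Mapping.keys x. scale (Poly_Mapping.lookup x g) (f g))"

lemma sv_extend_single:
  assumes "vector_space scale"
  shows "sv_extend scale f (Poly_Mapping.single g a) = scale a (f g)"
proof -
  interpret W: vector_space scale by fact
  show ?thesis by (simp add: sv_extend_def)
qed

lemma linear_sv_extend:
  assumes "vector_space scale"
  shows "Vector_Spaces.linear sv_scale scale (sv_extend scale f)"
proof -
  interpret W: vector_space scale by fact
  have "sv_extend scale f (x + y) = sv_extend scale f x + sv_extend scale f y" for x y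
    unfolding sv_extend_def
    by (rule setsum_keys_plus_distrib) (simp_all add: W.scale_left_distrib)
  \<comment> \<open>Scaling by 0 empties the support, so only a nonzero \<open>c\<close> leaves the
    index set of the sum unchanged.\<close>
  moreover have "sv_extend scale f (sv_scale c x) = scale c (sv_extend scale f x)" for c x
    by (cases "c = 0") (simp_all add: sv_extend_def keys_sv_scale W.scale_sum_right)
  ultimately show ?thesis
    using vector_space_sv_scale assms by (simp add: Vector_Spaces.linear_iff)
qed

text \<open>Every element is a finite combination of basis vectors, and linear maps commute with
  such sums. This reduces each later identity to generators, one argument at a time.\<close>

lemma sv_linear_eqI:
  assumes F: "Vector_Spaces.linear sv_scale scale F"
    and G: "Vector_Spaces.linear sv_scale scale G"
    and eq: "\<And>g. F (sv_basis g) = G (sv_basis g)"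
  shows "F x = G x"
proof -
  interpret F: Vector_Spaces.linear sv_scale scale F by fact
  interpret G: Vector_Spaces.linear sv_scale scale G by fact
  show ?thesis
    by (subst (1 2) sv_eq_sum_basis) (simp only: F.sum G.sum F.scale G.scale eq)
qed

section \<open>The Lie algebra axioms\<close>

lemma sv_bracket_eq_extend:
  "sv_bracket x y = sv_extend sv_scale (\<lambda>g. sv_extend sv_scale (sv_gen_bracket g) y) x"
  by (simp add: sv_bracket_def sv_extend_def sv.scale_sum_right)

lemma sv_bracket_linear_left: "Vector_Spaces.linear sv_scale sv_scale (\<lambda>x. sv_bracket x y)"
  unfolding sv_bracket_eq_extend by (rule linear_sv_extend[OF vector_space_sv_scale])

lemma sv_bracket_linear_right: "Vector_Spaces.linear sv_scale sv_scale (sv_bracket x)"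
proof -
  \<comment> \<open>For fixed \<open>x\<close> the bracket is a finite linear combination of the
    linear extensions of \<open>sv_gen_bracket g\<close>.\<close>
  have "Vector_Spaces.linear sv_scale sv_scale (\<lambda>y. \<Sum>g\<in>Poly_Mapping.keys x.
      sv_scale (Poly_Mapping.lookup x g) (sv_extend sv_scale (sv_gen_bracket g) y))"
    using linear_sv_extend[OF vector_space_sv_scale]
    by (auto simp: Vector_Spaces.linear_iff sum.distrib sv.scale_right_distrib
        sv.scale_sum_right mult.commute)
  then show ?thesis
    by (subst sv_bracket_eq_extend[abs_def]) (subst sv_extend_def, assumption)
qed

lemmas sv_bracket_bilinear =
  sv_bracket_linear_left[unfolded Vector_Spaces.linear_iff]
  sv_bracket_linear_right[unfolded Vector_Spaces.linear_iff]

lemma sv_bracket_single: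
  "sv_bracket (Poly_Mapping.single g a) (Poly_Mapping.single h b) =
    sv_scale (a * b) (sv_gen_bracket g h)"
  by (simp add: sv_bracket_def)

lemma sv_bracket_minus [simp]:
  "sv_bracket (- x) y = - sv_bracket x y" "sv_bracket x (- y) = - sv_bracket x y"
proof -
  interpret A: Vector_Spaces.linear sv_scale sv_scale "\<lambda>x. sv_bracket x y"
    by (rule sv_bracket_linear_left)
  interpret B: Vector_Spaces.linear sv_scale sv_scale "sv_bracket x"
    by (rule sv_bracket_linear_right)
  show "sv_bracket (- x) y = - sv_bracket x y" by (rule A.neg)
  show "sv_bracket x (- y) = - sv_bracket x y" by (rule B.neg)
qed

lemma sv_bracket_zero [simp]: "sv_bracket 0 y = 0" "sv_bracket x 0 = 0"
  by (simp_all add: sv_bracket_def)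

text \<open>Mixed pairs are antisymmetric by definition or have bracket 0; for two \<open>L\<close>
  or two \<open>Y\<close> the factor \<open>m - n\<close> changes sign.\<close>

lemma sv_gen_bracket_antisym: "sv_gen_bracket g h = - sv_gen_bracket h g"
  by (cases g; cases h)
    (auto simp: single_uminus[symmetric] add.commute)

lemma sv_bracket_antisym: "sv_bracket x y = - sv_bracket y x"
proof (rule sv_linear_eqI[where F = "\<lambda>x. sv_bracket x y" and G = "\<lambda>x. - sv_bracket y x"])
  show "Vector_Spaces.linear sv_scale sv_scale (\<lambda>x. sv_bracket x y)"
    by (rule sv_bracket_linear_left)
  show "Vector_Spaces.linear sv_scale sv_scale (\<lambda>x. - sv_bracket y x)"
    using sv_bracket_bilinear by (simp add: Vector_Spaces.linear_iff)
  show "sv_bracket (sv_basis g) y = - sv_bracket y (sv_basis g)" for g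
  proof (rule sv_linear_eqI[where F = "sv_bracket (sv_basis g)"
        and G = "\<lambda>y. - sv_bracket y (sv_basis g)"])
    show "Vector_Spaces.linear sv_scale sv_scale (sv_bracket (sv_basis g))"
      by (rule sv_bracket_linear_right)
    show "Vector_Spaces.linear sv_scale sv_scale (\<lambda>y. - sv_bracket y (sv_basis g))"
      using sv_bracket_bilinear by (simp add: Vector_Spaces.linear_iff)
    show "sv_bracket (sv_basis g) (sv_basis h) = - sv_bracket (sv_basis h) (sv_basis g)" for h
      using sv_gen_bracket_antisym[of g h] by (simp add: sv_bracket_single)
  qed
qed

lemma sv_bracket_self: "sv_bracket x x = 0"
proof (rule poly_mapping_eqI)
  fix g
  \<comment> \<open>Antisymmetry makes each coefficient equal to its own negative, which forces 0 in
    characteristic 0.\<close>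
  have "Poly_Mapping.lookup (sv_bracket x x) g = - Poly_Mapping.lookup (sv_bracket x x) g"
    by (subst sv_bracket_antisym) simp
  then show "Poly_Mapping.lookup (sv_bracket x x) g = Poly_Mapping.lookup 0 g" by simp
qed

text \<open>Naming the cyclic sum exposes its invariance under rotation, so that linearity in the
  first argument suffices for all three.\<close>

definition sv_jacobiator :: "sv \<Rightarrow> sv \<Rightarrow> sv \<Rightarrow> sv" where
  "sv_jacobiator x y z =
    sv_bracket x (sv_bracket y z) + sv_bracket y (sv_bracket z x) + sv_bracket z (sv_bracket x y)"

lemma sv_jacobiator_rotate: "sv_jacobiator x y z = sv_jacobiator y z x"
  by (simp add: sv_jacobiator_def add_ac)

lemma sv_jacobiator_linear: "Vector_Spaces.linear sv_scale sv_scale (\<lambda>x. sv_jacobiator x y z)"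
  using sv_bracket_bilinear
  by (simp add: Vector_Spaces.linear_iff sv_jacobiator_def sv.scale_right_distrib)

text \<open>For each choice of the three types, the nonzero terms are multiples of one basis vector,
  whose index is the sum of the three indices; their coefficients cancel.\<close>

lemma sv_jacobiator_basis: "sv_jacobiator (sv_basis f) (sv_basis g) (sv_basis h) = 0"
  by (cases f; cases g; cases h)
    (auto simp: sv_jacobiator_def sv_bracket_single single_uminus[symmetric] add_ac
      single_add[symmetric] field_simps)

lemma sv_jacobi: "sv_jacobiator x y z = 0"
proof -
  have zero: "Vector_Spaces.linear sv_scale sv_scale (\<lambda>x. 0)"
    using vector_space_sv_scale by (simp add: Vector_Spaces.linear_iff)
  note ext = sv_linear_eqI[OF sv_jacobiator_linear zero]
  have 1: "sv_jacobiator x (sv_basis g) (sv_basis h) = 0" for x g h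
    by (rule ext) (rule sv_jacobiator_basis)
  \<comment> \<open>The slot to be reduced is rotated to the front, replaced by a basis vector, and
    the result is rotated back to fit the previous case.\<close>
  have 2: "sv_jacobiator x y (sv_basis h) = 0" for x y h
    by (subst sv_jacobiator_rotate, rule ext, subst sv_jacobiator_rotate,
        subst sv_jacobiator_rotate) (rule 1)
  show ?thesis
    by (subst sv_jacobiator_rotate, subst sv_jacobiator_rotate, rule ext,
        subst sv_jacobiator_rotate) (rule 2)
qed

lemma lie_algebra_sv: "lie_algebra sv_scale sv_bracket"
  using sv_jacobi vector_space_sv_scale sv_bracket_linear_left sv_bracket_linear_right
    sv_bracket_self
  by (simp add: lie_algebra_def lie_algebra_axioms_def sv_jacobiator_def)

section \<open>Substitution and differentiation in three variables\<close>

lemma map_poly_add_hom: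
  assumes "h 0 = 0" and "\<And>x y. h (x + y) = h x + h y"
  shows "map_poly h (p + q) = map_poly h p + map_poly h q"
  using assms by (intro poly_eqI) (simp add: coeff_map_poly)

text \<open>Coefficients of a product are sums of products of coefficients, which \<open>h\<close>
  respects. Applied once for each of the two layers around the variable \<open>s\<close>, this makes
  \<open>shift_s\<close> multiplicative.\<close>

lemma map_poly_mult_hom:
  fixes h :: "'a::comm_semiring_0 \<Rightarrow> 'b::comm_semiring_0"
  assumes "h 0 = 0" and "\<And>x y. h (x + y) = h x + h y" and "\<And>x y. h (x * y) = h x * h y"
  shows "map_poly h (p * q) = map_poly h p * map_poly h q"
proof (rule poly_eqI)
  fix n
  have "h (sum f A) = (\<Sum>i\<in>A. h (f i))" for f :: "nat \<Rightarrow> 'a" and A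
    by (induction A rule: infinite_finite_induct) (simp_all add: assms)
  then show "coeff (map_poly h (p * q)) n = coeff (map_poly h p * map_poly h q) n"
    by (simp add: coeff_map_poly coeff_mult assms)
qed

text \<open>Embedding the constants turns scaling into multiplication, so that the module identities
  become ring identities.\<close>

definition const3 :: "complex \<Rightarrow> poly3" where
  "const3 c = [:[:[:c:]:]:]"

lemma poly3_scale_eq: "poly3_scale c f = const3 c * f"
  by (simp add: poly3_scale_def const3_def)

lemma const3_add: "const3 (a + b) = const3 a + const3 b"
  and const3_diff: "const3 (a - b) = const3 a - const3 b"
  and const3_mult: "const3 (a * b) = const3 a * const3 b"
  and const3_0: "const3 0 = 0"
  and const3_1: "const3 1 = 1"
  by (simp_all add: const3_def one_pCons)

lemma vector_space_poly3_scale: "vector_space poly3_scale"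
  by unfold_locales (simp_all add: poly3_scale_eq const3_add const3_mult const3_1 algebra_simps)

lemma shift_s_add: "shift_s m (f + g) = shift_s m f + shift_s m g"
  by (simp add: shift_s_def map_poly_add_hom pcompose_add)

lemma shift_s_mult: "shift_s m (f * g) = shift_s m f * shift_s m g"
  by (simp add: shift_s_def map_poly_mult_hom map_poly_add_hom pcompose_add pcompose_mult)

lemma shift_s_minus: "shift_s m (- f) = - shift_s m f"
proof -
  have "shift_s m (- f) + shift_s m f = 0"
    by (subst shift_s_add[symmetric]) (simp add: shift_s_def)
  then show ?thesis by (simp add: eq_neg_iff_add_eq_0)
qed

lemma shift_s_diff: "shift_s m (f - g) = shift_s m f - shift_s m g"
  using shift_s_add[of m f "- g"] by (simp add: shift_s_minus)

lemma shift_s_0 [simp]: "shift_s 0 f = f"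
  by (simp add: shift_s_def map_poly_idI)

lemma shift_s_shift_s: "shift_s m (shift_s n f) = shift_s (m + n) f"
proof -
  have "pcompose (pcompose p [:- of_int n, 1:]) [:- of_int m, 1:] =
      pcompose p [:- of_int (m + n), 1:]" for p :: "complex poly"
    by (simp add: pcompose_assoc[symmetric] pcompose_pCons minus_diff_commute)
  then show ?thesis
    by (simp add: shift_s_def map_poly_map_poly o_def)
qed

lemma pderiv_shift_s: "pderiv (shift_s m f) = shift_s m (pderiv f)"
proof (rule poly_eqI)
  fix n
  \<comment> \<open>The derivative in \<open>v\<close> only moves outer coefficients and multiplies
    them by natural numbers, and an additive map commutes with such multiples.\<close>
  have "map_poly (\<lambda>p. pcompose p [:- of_int m, 1:]) (of_nat k * q) =
      of_nat k * map_poly (\<lambda>p. pcompose p [:- of_int m, 1:]) q" for k and q :: "complex poly poly"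
    by (induction k) (simp_all add: map_poly_add_hom pcompose_add algebra_simps)
  then show "coeff (pderiv (shift_s m f)) n = coeff (shift_s m (pderiv f)) n"
    by (simp add: shift_s_def coeff_pderiv coeff_map_poly del: of_nat_Suc)
qed

lemma shift_s_const3: "shift_s m (const3 c) = const3 c"
  and shift_s_var_s: "shift_s m var_s = var_s - const3 (of_int m)"
  and shift_s_var_t: "shift_s m var_t = var_t"
  and shift_s_var_v: "shift_s m var_v = var_v"
  by (simp_all add: shift_s_def const3_def var_s_def var_t_def var_v_def map_poly_pCons
      pcompose_pCons pcompose_1)

text \<open>The second derivative of a product has a doubled mixed term; its factor 2 has to pass
  through the substitution.\<close>

lemma shift_s_two: "shift_s m 2 = 2"
  using shift_s_const3[of m 1] shift_s_add[of m 1 1] by (simp add: const3_1)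

lemma pderiv_const3: "pderiv (const3 c) = 0"
  and pderiv_var_s: "pderiv var_s = 0"
  and pderiv_var_t: "pderiv var_t = 0"
  and pderiv_var_v: "pderiv var_v = 1"
  by (simp_all add: const3_def var_s_def var_t_def var_v_def pderiv_pCons)

section \<open>Commutators of the operators attached to basis elements\<close>

lemmas Phi_simps =
  shift_s_add shift_s_mult shift_s_diff shift_s_shift_s pderiv_shift_s
  shift_s_two shift_s_const3 shift_s_var_s shift_s_var_t shift_s_var_v
  pderiv_add pderiv_diff pderiv_mult
  pderiv_const3 pderiv_var_s pderiv_var_t pderiv_var_v

text \<open>Writing \<open>m\<close> as twice \<open>m / 2\<close> leaves the half-integers as the
  only index-dependent constants in the ring identities.\<close>

lemma const3_of_int: "const3 (of_int m) = const3 (of_int m / 2) + const3 (of_int m / 2)"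
  by (simp add: const3_add[symmetric])

text \<open>A normal form for composing operators: derivatives stand inside the shift, and
  \<open>m^2 / 4\<close> is the square of \<open>m / 2\<close>.\<close>

lemma Phi_gen_action_eq:
  "Phi_gen_action lam \<alpha> (L m) f = const3 (lam powi m) *
     ((var_s + const3 (of_int m) * const3 \<alpha>) * shift_s m f
      - const3 (of_int m / 2) * var_v * shift_s m (pderiv f)
      + const3 (of_int m / 2) * const3 (of_int m / 2) * var_t * shift_s m (pderiv (pderiv f)))"
  "Phi_gen_action lam \<alpha> (M m) f = const3 (lam powi m) * (var_t * shift_s m f)"
  "Phi_gen_action lam \<alpha> (Y m) f = const3 (lam powi m) *
     (var_v * shift_s m f - const3 (of_int m) * var_t * shift_s m (pderiv f))"
  by (simp_all add: poly3_scale_eq const3_mult[symmetric] pderiv_shift_s mult.assoc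
      power2_eq_square)

declare Phi_gen_action.simps [simp del]

lemma Phi_gen_linear:
  "Vector_Spaces.linear poly3_scale poly3_scale (Phi_gen_action lam \<alpha> g)"
  using vector_space_poly3_scale
  by (cases g)
    (simp_all add: Vector_Spaces.linear_iff Phi_gen_action_eq poly3_scale_eq Phi_simps algebra_simps)

text \<open>Expanded, both sides are combinations of the shifts by \<open>m + n\<close> of
  \<open>f\<close> and its \<open>v\<close>-derivatives, and the coefficients agree. Since
  \<open>lam\<close> is nonzero, its integer powers add exponents.\<close>

lemma Phi_gen_commutators:
  assumes "lam \<noteq> 0"
  shows "const3 (of_int (m - n)) * Phi_gen_action lam \<alpha> (L (m + n)) f =
      Phi_gen_action lam \<alpha> (L n) (Phi_gen_action lam \<alpha> (L m) f) -
      Phi_gen_action lam \<alpha> (L m) (Phi_gen_action lam \<alpha> (L n) f)"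
    and "const3 (of_int m - of_int n / 2) * Phi_gen_action lam \<alpha> (Y (m + n)) f =
      Phi_gen_action lam \<alpha> (L n) (Phi_gen_action lam \<alpha> (Y m) f) -
      Phi_gen_action lam \<alpha> (Y m) (Phi_gen_action lam \<alpha> (L n) f)"
    and "const3 (of_int m) * Phi_gen_action lam \<alpha> (M (m + n)) f =
      Phi_gen_action lam \<alpha> (L n) (Phi_gen_action lam \<alpha> (M m) f) -
      Phi_gen_action lam \<alpha> (M m) (Phi_gen_action lam \<alpha> (L n) f)"
    and "const3 (of_int (m - n)) * Phi_gen_action lam \<alpha> (M (m + n)) f =
      Phi_gen_action lam \<alpha> (Y n) (Phi_gen_action lam \<alpha> (Y m) f) -
      Phi_gen_action lam \<alpha> (Y m) (Phi_gen_action lam \<alpha> (Y n) f)"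
    and "Phi_gen_action lam \<alpha> (Y n) (Phi_gen_action lam \<alpha> (M m) f) =
      Phi_gen_action lam \<alpha> (M m) (Phi_gen_action lam \<alpha> (Y n) f)"
    and "Phi_gen_action lam \<alpha> (M n) (Phi_gen_action lam \<alpha> (M m) f) =
      Phi_gen_action lam \<alpha> (M m) (Phi_gen_action lam \<alpha> (M n) f)"
  using assms
  by (simp_all add: Phi_gen_action_eq Phi_simps power_int_add const3_mult const3_add
      add_divide_distrib const3_diff const3_of_int add.commute[of n m] algebra_simps)


section \<open>The Lie module axioms for the whole algebra\<close>

lemma Phi_action_eq_extend:
  "Phi_action lam \<alpha> x f = sv_extend poly3_scale (\<lambda>g. Phi_gen_action lam \<alpha> g f) x"
  by (simp add: Phi_action_def sv_extend_def)

lemma Phi_action_linear_left: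
  "Vector_Spaces.linear sv_scale poly3_scale (\<lambda>x. Phi_action lam \<alpha> x f)"
  unfolding Phi_action_eq_extend by (rule linear_sv_extend[OF vector_space_poly3_scale])

lemma Phi_action_linear_right:
  "Vector_Spaces.linear poly3_scale poly3_scale (Phi_action lam \<alpha> x)"
proof -
  interpret P: vector_space poly3_scale by (rule vector_space_poly3_scale)
  show ?thesis
    using Phi_gen_linear[of lam \<alpha>]
    by (auto simp: Vector_Spaces.linear_iff Phi_action_def sum.distrib P.scale_right_distrib
        P.scale_sum_right mult.commute)
qed

lemma Phi_action_single:
  "Phi_action lam \<alpha> (Poly_Mapping.single g a) f = const3 a * Phi_gen_action lam \<alpha> g f"
  using sv_extend_single[OF vector_space_poly3_scale]
  by (simp add: Phi_action_eq_extend poly3_scale_eq)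

lemma Phi_action_minus: "Phi_action lam \<alpha> (- x) f = - Phi_action lam \<alpha> x f"
proof -
  interpret A: Vector_Spaces.linear sv_scale poly3_scale "\<lambda>x. Phi_action lam \<alpha> x f"
    by (rule Phi_action_linear_left)
  show ?thesis by (rule A.neg)
qed

text \<open>The six commutators cover one order of each pair of types; reversing the order changes
  the sign on both sides.\<close>

lemma Phi_action_gen_bracket:
  assumes "lam \<noteq> 0"
  shows "Phi_action lam \<alpha> (sv_gen_bracket g h) f =
    Phi_gen_action lam \<alpha> g (Phi_gen_action lam \<alpha> h f) -
    Phi_gen_action lam \<alpha> h (Phi_gen_action lam \<alpha> g f)"
  using Phi_gen_commutators[OF assms, where \<alpha> = \<alpha> and f = f]
  by (cases g; cases h) (simp_all add: Phi_action_single Phi_action_minus Phi_action_def[of _ _ 0])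

text \<open>Both sides are linear in \<open>x\<close> and in \<open>y\<close>, so each argument in
  turn may be taken to be a basis vector.\<close>

lemma Phi_action_bracket:
  assumes "lam \<noteq> 0"
  shows "Phi_action lam \<alpha> (sv_bracket x y) f =
    Phi_action lam \<alpha> x (Phi_action lam \<alpha> y f) - Phi_action lam \<alpha> y (Phi_action lam \<alpha> x f)"
proof -
  interpret P: vector_space poly3_scale by (rule vector_space_poly3_scale)
  note lin = sv_bracket_bilinear
    Phi_action_linear_left[of lam \<alpha>, unfolded Vector_Spaces.linear_iff]
    Phi_action_linear_right[of lam \<alpha>, unfolded Vector_Spaces.linear_iff]
  show ?thesis
  proof (rule sv_linear_eqI[where F = "\<lambda>x. Phi_action lam \<alpha> (sv_bracket x y) f" and
        G = "\<lambda>x. Phi_action lam \<alpha> x (Phi_action lam \<alpha> y f) -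
          Phi_action lam \<alpha> y (Phi_action lam \<alpha> x f)"])
    show "Vector_Spaces.linear sv_scale poly3_scale (\<lambda>x. Phi_action lam \<alpha> (sv_bracket x y) f)"
      using lin by (simp add: Vector_Spaces.linear_iff)
    show "Vector_Spaces.linear sv_scale poly3_scale
        (\<lambda>x. Phi_action lam \<alpha> x (Phi_action lam \<alpha> y f) -
          Phi_action lam \<alpha> y (Phi_action lam \<alpha> x f))"
      using lin by (simp add: Vector_Spaces.linear_iff P.scale_right_diff_distrib)
    fix g
    let ?g = "sv_basis g"
    show "Phi_action lam \<alpha> (sv_bracket ?g y) f =
        Phi_action lam \<alpha> ?g (Phi_action lam \<alpha> y f) - Phi_action lam \<alpha> y (Phi_action lam \<alpha> ?g f)"
    proof (rule sv_linear_eqI[where F = "\<lambda>y. Phi_action lam \<alpha> (sv_bracket ?g y) f" and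
          G = "\<lambda>y. Phi_action lam \<alpha> ?g (Phi_action lam \<alpha> y f) -
            Phi_action lam \<alpha> y (Phi_action lam \<alpha> ?g f)"])
      show "Vector_Spaces.linear sv_scale poly3_scale (\<lambda>y. Phi_action lam \<alpha> (sv_bracket ?g y) f)"
        using lin by (simp add: Vector_Spaces.linear_iff)
      show "Vector_Spaces.linear sv_scale poly3_scale
          (\<lambda>y. Phi_action lam \<alpha> ?g (Phi_action lam \<alpha> y f) -
            Phi_action lam \<alpha> y (Phi_action lam \<alpha> ?g f))"
        using lin by (simp add: Vector_Spaces.linear_iff P.scale_right_diff_distrib)
      show "Phi_action lam \<alpha> (sv_bracket ?g (sv_basis h)) f =
          Phi_action lam \<alpha> ?g (Phi_action lam \<alpha> (sv_basis h) f) -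
          Phi_action lam \<alpha> (sv_basis h) (Phi_action lam \<alpha> ?g f)" for h
        using Phi_action_gen_bracket[OF assms, of \<alpha> g h f]
        by (simp add: sv_bracket_single Phi_action_single const3_1)
    qed
  qed
qed

lemma lie_module_Phi:
  assumes "lam \<noteq> 0"
  shows "lie_module sv_scale sv_bracket poly3_scale (Phi_action lam \<alpha>)"
  using lie_algebra_sv vector_space_poly3_scale Phi_action_linear_left Phi_action_linear_right
    Phi_action_bracket[OF assms]
  by (simp add: lie_module_def lie_module_axioms_def)

section \<open>Freeness over the enveloping algebra\<close>

lemma poly3_eq_sum:
  "u = (\<Sum>k\<le>degree u. \<Sum>j\<le>degree (coeff u k). \<Sum>i\<le>degree (coeff (coeff u k) j).
    const3 (coeff (coeff (coeff u k) j) i) * var_s ^ i * var_t ^ j * var_v ^ k)"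
proof -
  have pow: "[:p:] ^ n = [:p ^ n:]" for p :: "'a::comm_ring_1" and n
    by (induction n) (simp_all add: one_pCons)
  have sum1: "(\<Sum>i\<in>A. [:f i:]) = [:\<Sum>i\<in>A. f i:]" for f :: "nat \<Rightarrow> 'a::comm_ring_1" and A
    by (induction A rule: infinite_finite_induct) simp_all
  have mono: "(\<Sum>i\<le>degree p. [:coeff p i:] * [:0, 1:] ^ i) = p" for p :: "'a::comm_ring_1 poly"
    using poly_as_sum_of_monoms[of p] by (simp add: monom_altdef)
  \<comment> \<open>The triple sum collapses from the inside out: first the powers of
    \<open>s\<close>, then those of \<open>t\<close>, finally those of \<open>v\<close>.\<close>
  have s: "(\<Sum>i\<le>degree p. const3 (coeff p i) * var_s ^ i) = [:[:p:]:]" for p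
    using mono[of p] by (simp add: const3_def var_s_def pow sum1 del: mult_pCons_left)
  have t: "(\<Sum>j\<le>degree q. [:[:coeff q j:]:] * var_t ^ j) = [:q:]" for q :: "complex poly poly"
    using mono[of q] by (simp add: var_t_def pow sum1)
  have "(\<Sum>k\<le>degree u. \<Sum>j\<le>degree (coeff u k). \<Sum>i\<le>degree (coeff (coeff u k) j).
      const3 (coeff (coeff (coeff u k) j) i) * var_s ^ i * var_t ^ j * var_v ^ k) =
    (\<Sum>k\<le>degree u. [:coeff u k:] * var_v ^ k)"
    by (simp only: sum_distrib_right[symmetric] s t)
  also have "\<dots> = u"
    using mono[of u] by (simp add: var_v_def)
  finally show ?thesis by simp
qed

lemma U0_action_Phi: "U0_action poly3_scale (Phi_action lam \<alpha>) u w = u * w"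
proof -
  have pow: "((*) p ^^ n) f = p ^ n * f" for p f :: poly3 and n
    by (induction n) (simp_all add: mult.assoc)
  \<comment> \<open>At index 0 the shift is the identity, the power of \<open>lam\<close> is 1, and
    every correction term carries a factor 0.\<close>
  have gens: "Phi_action lam \<alpha> (sv_basis (L 0)) = (*) var_s"
    "Phi_action lam \<alpha> (sv_basis (M 0)) = (*) var_t"
    "Phi_action lam \<alpha> (sv_basis (Y 0)) = (*) var_v"
    by (simp_all add: fun_eq_iff Phi_action_single Phi_gen_action_eq const3_0 const3_1)
  show ?thesis
    \<comment> \<open>Only the factor \<open>u\<close> of the product \<open>u * w\<close> is
      expanded; its monomials then match the sum defining \<open>U0_action\<close>.\<close>
    by (subst (4) poly3_eq_sum)
      (simp add: U0_action_def gens pow poly3_scale_eq sum_distrib_right mult.assoc)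
qed

text \<open>The basis is \<open>{1}\<close>: \<open>c * 1 = 0\<close> forces \<open>c = 0\<close>,
  and every \<open>c\<close> equals \<open>c * 1\<close>.\<close>

lemma free_module_mult: "free_module_of_rank ((*) :: 'a::comm_ring_1 \<Rightarrow> 'a \<Rightarrow> 'a) 1"
proof -
  interpret module "(*) :: 'a \<Rightarrow> 'a \<Rightarrow> 'a"
    by unfold_locales (simp_all add: algebra_simps)
  have "independent {1}"
    using dependent_finite[of "{1}"] by auto
  moreover have "span {1} = UNIV"
    by (auto simp: span_singleton)
  ultimately show ?thesis
    unfolding free_module_of_rank_def using module_axioms by (intro conjI exI[of _ "{1}"]) auto
qed

theorem proposition2p4:
  fixes lam \<alpha> :: complex
  assumes "lam \<noteq> 0"
  shows "lie_module sv_scale sv_bracket poly3_scale (Phi_action lam \<alpha>) \<and>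
    free_module_of_rank (U0_action poly3_scale (Phi_action lam \<alpha>)) 1"
proof -
  \<comment> \<open>The module is the regular module of the polynomial ring, so its freeness is that
    of a ring over itself.\<close>
  have "U0_action poly3_scale (Phi_action lam \<alpha>) = (*)"
    by (simp add: fun_eq_iff U0_action_Phi)
  then show ?thesis
    using lie_module_Phi[OF assms] free_module_mult[where 'a = poly3] by simp
qed

end
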